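(* A sum-based discrete $R_2$ acquisition can be implemented by updating $K$ scalar envelope values, training $K$ scalar achievement surrogates, and maximizing the average of $K$ scalar Gaussian expected improvements.
   Context: Setting: sequential (Bayesian) minimization of an expensive vector-valued function $f=(f_1,\dots,f_m)$ that has been evaluated at designs $x_1,\dots,x_n$. $\{\lambda^{(1)},\dots,\lambda^{(K)}\}\subset\Delta^{m-1}=\{\lambda\in\mathbb{R}_+^m:\sum_i\lambda_i=1\}$ is a discrete weight set, $z^+$ a utopian point, and $g_\lambda(y;z^+)=\max_i\lambda_i(y_i-z_i^+)$ the weighted Tchebycheff achievement function. The $K$ scalar envelope values are $h_{n,k}=\min_i g_{\lambda^{(k)}}(f(x_i);z^+)$, $k=1,\dots,K$. The $K$ scalar achievement surrogates are scalar Gaussian process models, one for each achievement function $x\mapsto g_{\lambda^{(k)}}(f(x);z^+)$, trained on the pairs $(x_i,g_{\lambda^{(k)}}(f(x_i);z^+))$, with predictive mean $m_k(x)$ and standard deviation $s_k(x)$. The sum-based discrete $R_2$ acquisition (discrete expected $R_2$-indicator improvement) is the finite sum $\frac1K\sum_{k=1}^K\mathrm{EI}(h_{n,k};m_k(x),s_k(x))$, to be maximized over the design domain, where $\mathrm{EI}(c;\mu,s)=(c-\mu)\Phi\!\left(\frac{c-\mu}{s}\right)+s\,\varphi\!\left(\frac{c-\mu}{s}\right)$ is scalar Gaussian expected improvement and $\Phi,\varphi$ are the standard normal distribution function and density. After the selected design is evaluated, the envelope values are updated and the procedure is repeated. *)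

theory Defs
  imports "HOL-Probability.Probability" "Jordan_Normal_Form.Gauss_Jordan_Elimination"
begin

no_notation vec_index (infixl \<open>$\<close> 100)

definition weight_simplex :: "(real ^ 'm) set" where
  "weight_simplex = {l. (\<forall>i. 0 \<le> l $ i) \<and> (\<Sum>i\<in>UNIV. l $ i) = 1}"

(* Strict utopian points (strictly below every attained value) are included. *)
definition utopian_point :: "'x set \<Rightarrow> ('x \<Rightarrow> real ^ 'm) \<Rightarrow> real ^ 'm \<Rightarrow> bool" where
  "utopian_point X f z \<longleftrightarrow> (\<forall>x\<in>X. \<forall>i. z $ i \<le> f x $ i)"

definition tchebycheff :: "real ^ 'm \<Rightarrow> real ^ 'm \<Rightarrow> real ^ 'm \<Rightarrow> real" where
  "tchebycheff z l y = Max (range (\<lambda>i. l $ i * (y $ i - z $ i)))"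

(* The vector of scalar achievement values of a design; only indices k < K are meaningful. *)
definition achievement ::
    "('x \<Rightarrow> real ^ 'm) \<Rightarrow> real ^ 'm \<Rightarrow> (nat \<Rightarrow> real ^ 'm) \<Rightarrow> 'x \<Rightarrow> nat \<Rightarrow> real" where
  "achievement f z lam x k = tchebycheff z (lam k) (f x)"

definition envelope :: "('x \<Rightarrow> nat \<Rightarrow> real) \<Rightarrow> 'x list \<Rightarrow> nat \<Rightarrow> real" where
  "envelope a xs k = Min ((\<lambda>x. a x k) ` set xs)"

(* The discrete R2 indicator (1/K) * SUM k. min over y of g_k(y) depends on an outcome y only
   through its achievement vector, so it is written as a function of a finite set of achievement
   vectors. This allows a vector of predicted achievement values to be inserted. *)
definition r2_indicator :: "nat \<Rightarrow> (nat \<Rightarrow> real) set \<Rightarrow> real" where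
  "r2_indicator K A = (\<Sum>k<K. Min ((\<lambda>v. v k) ` A)) / real K"

definition r2_improvement :: "nat \<Rightarrow> (nat \<Rightarrow> real) set \<Rightarrow> (nat \<Rightarrow> real) \<Rightarrow> real" where
  "r2_improvement K A v = r2_indicator K A - r2_indicator K (insert v A)"

record 'x gp_prior =
  prior_mean :: "'x \<Rightarrow> real"
  kernel :: "'x \<Rightarrow> 'x \<Rightarrow> real"
  noise_var :: real

(* Symmetric positive semidefinite covariance on X. The points p i need not be distinct.
   Noise variance 0 (interpolation) is allowed. *)
definition valid_gp_prior :: "'x set \<Rightarrow> 'x gp_prior \<Rightarrow> bool" where
  "valid_gp_prior X P \<longleftrightarrow>
     (\<forall>x\<in>X. \<forall>y\<in>X. kernel P x y = kernel P y x) \<and>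
     (\<forall>n (p :: nat \<Rightarrow> 'x) (c :: nat \<Rightarrow> real). (\<forall>i<n. p i \<in> X) \<longrightarrow>
        0 \<le> (\<Sum>i<n. \<Sum>j<n. c i * c j * kernel P (p i) (p j))) \<and>
     0 \<le> noise_var P"

definition gram_mat :: "'x gp_prior \<Rightarrow> ('x \<times> real) list \<Rightarrow> real mat" where
  "gram_mat P D = mat (length D) (length D)
     (\<lambda>(i, j). kernel P (fst (D ! i)) (fst (D ! j)) + (if i = j then noise_var P else 0))"

definition cross_cov :: "'x gp_prior \<Rightarrow> ('x \<times> real) list \<Rightarrow> 'x \<Rightarrow> real vec" where
  "cross_cov P D x = vec (length D) (\<lambda>i. kernel P (fst (D ! i)) x)"

definition residuals :: "'x gp_prior \<Rightarrow> ('x \<times> real) list \<Rightarrow> real vec" where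
  "residuals P D = vec (length D) (\<lambda>i. snd (D ! i) - prior_mean P (fst (D ! i)))"

(* Standard conditioning formulas for the latent process given the data D. They are meaningful
   when the (noise-augmented) Gram matrix is invertible. *)
definition gp_mean :: "'x gp_prior \<Rightarrow> ('x \<times> real) list \<Rightarrow> 'x \<Rightarrow> real" where
  "gp_mean P D x = prior_mean P x +
     scalar_prod (cross_cov P D x) (the (mat_inverse (gram_mat P D)) *\<^sub>v residuals P D)"

definition gp_var :: "'x gp_prior \<Rightarrow> ('x \<times> real) list \<Rightarrow> 'x \<Rightarrow> real" where
  "gp_var P D x = kernel P x x -
     scalar_prod (cross_cov P D x) (the (mat_inverse (gram_mat P D)) *\<^sub>v cross_cov P D x)"

definition gp_sd :: "'x gp_prior \<Rightarrow> ('x \<times> real) list \<Rightarrow> 'x \<Rightarrow> real" where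
  "gp_sd P D x = sqrt (gp_var P D x)"

definition training_pairs :: "('x \<Rightarrow> nat \<Rightarrow> real) \<Rightarrow> 'x list \<Rightarrow> nat \<Rightarrow> ('x \<times> real) list" where
  "training_pairs a xs k = map (\<lambda>x. (x, a x k)) xs"

(* Training on D: the rule fit selects the prior (hyperparameters) from the data, and the
   resulting process is conditioned on the same data. The result is the pair of predictive
   mean and predictive standard deviation functions. *)
definition train ::
    "(('x \<times> real) list \<Rightarrow> 'x gp_prior) \<Rightarrow> ('x \<times> real) list \<Rightarrow> ('x \<Rightarrow> real) \<times> ('x \<Rightarrow> real)" where
  "train fit D = (gp_mean (fit D) D, gp_sd (fit D) D)"

abbreviation std_normal_cdf :: "real \<Rightarrow> real" where
  "std_normal_cdf \<equiv> cdf std_normal_distribution"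

(* For s = 0 the closed form is read as its limit as s tends to 0 from the right; with the
   HOL convention c / 0 = 0 the formula itself would give the wrong value (c - mu) / 2. *)
definition EI :: "real \<Rightarrow> real \<Rightarrow> real \<Rightarrow> real" where
  "EI c \<mu> s = (if s = 0 then max (c - \<mu>) 0
     else (c - \<mu>) * std_normal_cdf ((c - \<mu>) / s) + s * std_normal_density ((c - \<mu>) / s))"

(* The Gaussian law N(mu, s^2), degenerate for s = 0. *)
definition gaussian :: "real \<Rightarrow> real \<Rightarrow> real measure" where
  "gaussian \<mu> s = (if s = 0 then return borel \<mu> else density lborel (normal_density \<mu> s))"

definition r2_acquisition ::
    "nat \<Rightarrow> (nat \<Rightarrow> ('x \<times> real) list \<Rightarrow> 'x gp_prior) \<Rightarrow> ('x \<Rightarrow> nat \<Rightarrow> real)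
      \<Rightarrow> 'x list \<Rightarrow> 'x \<Rightarrow> real" where
  "r2_acquisition K fit a xs x =
     1 / real K * (\<Sum>k<K. EI (envelope a xs k)
       (fst (train (fit k) (training_pairs a xs k)) x)
       (snd (train (fit k) (training_pairs a xs k)) x))"

(* Archives reachable from the initial designs xs0 by sequential maximization of the acquisition
   over X. Ties between maximizers are broken arbitrarily. *)
inductive r2_run ::
    "'x set \<Rightarrow> nat \<Rightarrow> (nat \<Rightarrow> ('x \<times> real) list \<Rightarrow> 'x gp_prior) \<Rightarrow> ('x \<Rightarrow> nat \<Rightarrow> real)
      \<Rightarrow> 'x list \<Rightarrow> 'x list \<Rightarrow> bool" for X K fit a xs0 where
  init: "r2_run X K fit a xs0 xs0"
| step: "r2_run X K fit a xs0 xs \<Longrightarrow>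
    is_arg_max (r2_acquisition K fit a xs) (\<lambda>x. x \<in> X) x \<Longrightarrow>
    r2_run X K fit a xs0 (xs @ [x])"

(* Only scalar data are stored: for each k < K one envelope value and one training set. *)
record 'x scalar_state =
  env :: "nat \<Rightarrow> real"
  train_data :: "nat \<Rightarrow> ('x \<times> real) list"

definition scalar_init :: "('x \<Rightarrow> nat \<Rightarrow> real) \<Rightarrow> 'x list \<Rightarrow> 'x scalar_state" where
  "scalar_init a xs0 = \<lparr>env = envelope a xs0, train_data = training_pairs a xs0\<rparr>"

(* v is the vector of achievement values observed at the new design x. *)
definition scalar_update :: "'x \<Rightarrow> (nat \<Rightarrow> real) \<Rightarrow> 'x scalar_state \<Rightarrow> 'x scalar_state" where
  "scalar_update x v S =
     \<lparr>env = (\<lambda>k. min (env S k) (v k)), train_data = (\<lambda>k. train_data S k @ [(x, v k)])\<rparr>"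

definition average_EI ::
    "nat \<Rightarrow> (nat \<Rightarrow> ('x \<times> real) list \<Rightarrow> 'x gp_prior) \<Rightarrow> 'x scalar_state \<Rightarrow> 'x \<Rightarrow> real" where
  "average_EI K fit S x =
     (\<Sum>k<K. let (m, s) = train (fit k) (train_data S k) in EI (env S k) (m x) (s x)) / real K"

inductive scalar_run ::
    "'x set \<Rightarrow> nat \<Rightarrow> (nat \<Rightarrow> ('x \<times> real) list \<Rightarrow> 'x gp_prior) \<Rightarrow> ('x \<Rightarrow> nat \<Rightarrow> real)
      \<Rightarrow> 'x list \<Rightarrow> 'x list \<Rightarrow> 'x scalar_state \<Rightarrow> bool" for X K fit a xs0 where
  init: "scalar_run X K fit a xs0 xs0 (scalar_init a xs0)"
| step: "scalar_run X K fit a xs0 xs S \<Longrightarrow>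
    is_arg_max (average_EI K fit S) (\<lambda>x. x \<in> X) x \<Longrightarrow>
    scalar_run X K fit a xs0 (xs @ [x]) (scalar_update x (a x) S)"

end

theory Submission
  imports Defs
begin

text \<open>
  Two facts carry the result. The first is about the data that the acquisition reads from
  the archive of evaluated designs: the envelope values and the scalar training sets. Appending
  one design changes each envelope value by a binary minimum and each training set by one pair,
  so a procedure that stores only these scalars always holds exactly the values
  recomputed from the whole archive (\<open>scalar_run_state\<close>). Both procedures then
  maximize the same function at every step, which gives the same set of possible archives
  however ties between maximizers are broken.

  The second fact explains why this function deserves its name. Inserting a vector \<open>v\<close>
  into the finite set of achievement vectors lowers the discrete R2 indicator by the average over
  \<open>k\<close> of \<open>max (h\<^sub>k - v\<^sub>k) 0\<close>, where \<open>h\<^sub>k\<close> is the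
  \<open>k\<close>-th envelope value (\<open>r2_improvement_eq_average_shortfall\<close>). Each
  summand depends on one coordinate of \<open>v\<close>, so by linearity of expectation only the marginal
  laws matter and the surrogates may have any joint distribution. Under a Gaussian marginal
  each term has the closed form \<open>EI\<close> (\<open>gaussian_expected_improvement\<close>). That
  closed form needs a nonnegative scale parameter; for the predictive standard deviation this means
  that the posterior variance is nonnegative, a Schur complement argument
  (\<open>gp_var_nonneg\<close>). Its sign is a genuine issue because \<open>sqrt\<close> maps negative
  reals to negative reals.
\<close>

section \<open>Nonnegativity of the predictive variance\<close>

lemma mat_inverse_of_invertible:
  fixes A :: "'a :: field mat"
  assumes A: "A \<in> carrier_mat n n" and inv: "invertible_mat A"
  shows "A * the (mat_inverse A) = 1\<^sub>m n \<and> the (mat_inverse A) \<in> carrier_mat n n"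
proof -
  obtain B where B: "A * B = 1\<^sub>m n" "B * A = 1\<^sub>m (dim_row B)"
    using inv A unfolding invertible_mat_def inverts_mat_def by auto
  have "dim_col B = n"
    using arg_cong[OF B(1), of dim_col] by simp
  moreover have "dim_row B = n"
    using arg_cong[OF B(2), of dim_col] A by simp
  ultimately have "B \<in> carrier_mat n n" by auto
  then have "A \<in> Units (ring_mat TYPE('a) n ())"
    using A B unfolding Units_def by (auto simp: ring_mat_simps)
  then obtain C where "mat_inverse A = Some C"
    using mat_inverse(1)[OF A, where b = "()"] by (cases "mat_inverse A") auto
  then show ?thesis using mat_inverse(2)[OF A] by auto
qed

text \<open>
  The posterior variance is the prior variance of the prediction error
  \<open>Y x - (\<Sum>i. w\<^sub>i * Y (p\<^sub>i))\<close> of the latent process \<open>Y\<close>, plus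
  the noise contribution \<open>\<sigma>\<^sup>2 * (\<Sum>i. w\<^sub>i * w\<^sub>i)\<close>,
  where \<open>\<sigma>\<^sup>2\<close> is the noise variance, the \<open>p\<^sub>i\<close> are the
  training points and \<open>w\<close> is the solution of the Gram system with the cross
  covariances on the right. The first term is a value of the quadratic form of the kernel, which
  is nonnegative.
\<close>

lemma gp_var_nonneg:
  assumes P: "valid_gp_prior X P" and D: "fst ` set D \<subseteq> X" and x: "x \<in> X"
    and inv: "invertible_mat (gram_mat P D)"
  shows "0 \<le> gp_var P D x"
proof -
  define n where "n = length D"
  define w where "w = the (mat_inverse (gram_mat P D)) *\<^sub>v cross_cov P D x"
  define u where "u i = vec_index w i" for i
  \<comment> \<open>The test point is appended to the training points, with coefficient 1; the
    coefficients of the training points are the negated solution, as in the prediction error.\<close>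
  define p where "p i = (if i < n then fst (D ! i) else x)" for i
  define c where "c i = (if i < n then - u i else 1)" for i
  have A: "gram_mat P D \<in> carrier_mat n n" by (simp add: gram_mat_def n_def)
  have cc: "cross_cov P D x \<in> carrier_vec n" by (simp add: cross_cov_def n_def)
  note B = mat_inverse_of_invertible[OF A inv]
  have w: "w \<in> carrier_vec n" using B cc unfolding w_def by auto
  have "gram_mat P D *\<^sub>v w = cross_cov P D x"
    unfolding w_def using A B cc
    by (subst assoc_mult_mat_vec[symmetric, of _ n n _ n]) auto
  then have row: "(\<Sum>j<n. kernel P (p i) (p j) * u j) + noise_var P * u i = kernel P (p i) x"
    if "i < n" for i
  proof -
    have "kernel P (p i) x = vec_index (gram_mat P D *\<^sub>v w) i"
      using that \<open>gram_mat P D *\<^sub>v w = cross_cov P D x\<close> by (simp add: cross_cov_def p_def n_def)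
    also have "\<dots> = (\<Sum>j<n. (kernel P (p i) (p j) + (if i = j then noise_var P else 0)) * u j)"
      using that w
      by (auto simp: gram_mat_def scalar_prod_def n_def u_def p_def lessThan_atLeast0 intro!: sum.cong)
    also have "\<dots> = (\<Sum>j<n. kernel P (p i) (p j) * u j + (if j = i then noise_var P * u j else 0))"
      by (intro sum.cong) (auto simp: algebra_simps)
    also have "\<dots> = (\<Sum>j<n. kernel P (p i) (p j) * u j) + noise_var P * u i"
      using that by (simp add: sum.distrib sum.delta)
    finally show ?thesis by simp
  qed
  have pX: "p i \<in> X" for i
    using D x by (auto simp: p_def n_def)
  have sym: "kernel P x (p i) = kernel P (p i) x" for i
    using P pX x unfolding valid_gp_prior_def by blast
  have var: "gp_var P D x = kernel P x x - (\<Sum>i<n. u i * kernel P (p i) x)"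
    using w unfolding gp_var_def w_def[symmetric]
    by (auto simp: scalar_prod_def cross_cov_def u_def p_def n_def lessThan_atLeast0 mult.commute
        intro!: sum.cong)
  have pn: "p n = x" "c n = 1" and ci: "\<And>i. i < n \<Longrightarrow> c i = - u i"
    by (auto simp: p_def c_def)
  have "0 \<le> (\<Sum>i<Suc n. \<Sum>j<Suc n. c i * c j * kernel P (p i) (p j))"
    using P pX unfolding valid_gp_prior_def by blast
  also have "\<dots> = (\<Sum>i<n. \<Sum>j<n. c i * c j * kernel P (p i) (p j))
      + (\<Sum>i<n. c i * kernel P (p i) x) + (\<Sum>j<n. c j * kernel P (p j) x) + kernel P x x"
    by (simp add: pn sum.distrib sym)
  also have "(\<Sum>i<n. \<Sum>j<n. c i * c j * kernel P (p i) (p j))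
      = (\<Sum>i<n. u i * (\<Sum>j<n. kernel P (p i) (p j) * u j))"
    by (simp add: ci sum_distrib_left ac_simps)
  also have "\<dots> = (\<Sum>i<n. u i * (kernel P (p i) x - noise_var P * u i))"
    by (intro sum.cong) (auto simp: row[symmetric])
  also have "\<dots> = (\<Sum>i<n. u i * kernel P (p i) x) - noise_var P * (\<Sum>i<n. u i * u i)"
    by (simp add: right_diff_distrib sum_subtractf sum_distrib_left ac_simps)
  also have "(\<Sum>i<n. c i * kernel P (p i) x) = - (\<Sum>i<n. u i * kernel P (p i) x)"
    by (simp add: ci sum_negf)
  finally have "noise_var P * (\<Sum>i<n. u i * u i) \<le> gp_var P D x"
    unfolding var by simp
  moreover have "0 \<le> noise_var P * (\<Sum>i<n. u i * u i)"
    using P unfolding valid_gp_prior_def by (intro mult_nonneg_nonneg sum_nonneg zero_le_square) blast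
  ultimately show ?thesis by simp
qed

section \<open>Gaussian expected improvement\<close>

text \<open>
  This differential equation makes the first moment over a half-line elementary: the
  standard normal density is itself an antiderivative of \<open>- z\<close> times the density.
\<close>

lemma std_normal_density_has_derivative:
  "(std_normal_density has_real_derivative - z * std_normal_density z) (at z)"
  unfolding std_normal_density_def
  by (auto intro!: derivative_eq_intros simp: field_simps)

lemma integral_std_normal_below:
  "(LINT z|std_normal_distribution. indicator {..t} z * - z) = std_normal_density t"
proof -
  let ?f = "\<lambda>z. - z * std_normal_density z"
  have int: "integrable lborel ?f"
    using integrable_std_normal_moment[of 1] by (simp add: mult.commute)
  have "(LBINT z=-\<infinity>..ereal t. ?f z) = std_normal_density t - 0"
  proof (rule interval_integral_FTC_integrable)
    show "(std_normal_density has_vector_derivative ?f z) (at z)" for z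
      using std_normal_density_has_derivative
      by (simp add: has_real_derivative_iff_has_vector_derivative)
    show "isCont ?f z" for z
      unfolding std_normal_density_def by (intro continuous_intros) auto
    show "set_integrable lborel (einterval (-\<infinity>) (ereal t)) ?f"
      unfolding set_integrable_def using int by (rule integrable_mult_indicator[rotated]) simp
    have "(std_normal_density \<longlongrightarrow> 0) at_bot"
      unfolding std_normal_density_def by real_asymp
    then show "((std_normal_density \<circ> real_of_ereal) \<longlongrightarrow> 0) (at_right (-\<infinity>))"
      by (simp add: ereal_tendsto_simps)
    have "(std_normal_density \<longlongrightarrow> std_normal_density t) (at_left t)"
      using isCont_def std_normal_density_has_derivative DERIV_isCont
        filterlim_at_split by blast
    then show "((std_normal_density \<circ> real_of_ereal) \<longlongrightarrow> std_normal_density t) (at_left (ereal t))"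
      by (simp add: ereal_tendsto_simps)
  qed simp
  \<comment> \<open>The fundamental theorem gives the open half-line; the closed one, as used by the
    distribution function, differs from it by a null set.\<close>
  also have "(LBINT z=-\<infinity>..ereal t. ?f z) = (LINT z|lborel. std_normal_density z * (indicator {..t} z * - z))"
    unfolding interval_lebesgue_integral_def set_lebesgue_integral_def
    using AE_lborel_singleton[of t]
    by (auto simp: einterval_def indicator_def intro!: integral_cong_AE)
  also have "\<dots> = (LINT z|std_normal_distribution. indicator {..t} z * - z)"
    by (subst integral_density) auto
  finally show ?thesis by simp
qed

text \<open>
  On \<open>z \<le> t\<close> the shortfall is \<open>t - z\<close>. The constant part integrates to
  \<open>t\<close> times the distribution function and the part \<open>- z\<close> to the density.
\<close>

lemma std_normal_expected_shortfall:
  shows "integrable std_normal_distribution (\<lambda>z. max (t - z) 0)"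
    and "(LINT z|std_normal_distribution. max (t - z) 0) = t * std_normal_cdf t + std_normal_density t"
proof -
  interpret real_distribution std_normal_distribution by (rule real_dist_normal_dist)
  have id: "integrable std_normal_distribution (\<lambda>z. z)"
    using integrable_std_normal_distribution_moment[of 1] by simp
  have split: "max (t - z) 0 = t * indicator {..t} z + indicator {..t} z * - z" for z :: real
    by (auto simp: indicator_def)
  have i1: "integrable std_normal_distribution (\<lambda>z. t * indicator {..t} z :: real)"
    by (intro integrable_mult_right integrable_real_indicator) (auto simp: emeasure_eq_measure)
  have i2: "integrable std_normal_distribution (\<lambda>z. indicator {..t} z * - z)"
    using integrable_mult_indicator[of "{..t}" std_normal_distribution "\<lambda>z. - z"] id by simp
  show "integrable std_normal_distribution (\<lambda>z. max (t - z) 0)"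
    unfolding split using i1 i2 by (rule Bochner_Integration.integrable_add)
  show "(LINT z|std_normal_distribution. max (t - z) 0) = t * std_normal_cdf t + std_normal_density t"
    unfolding split using Bochner_Integration.integral_add[OF i1 i2]
    unfolding integral_std_normal_below by (simp add: cdf_def2)
qed

text \<open>
  Writing the Gaussian law as an affine image treats the degenerate case \<open>s = 0\<close> and the
  case with a density alike, so that integrals transfer to the standard normal law
  without a case distinction.
\<close>

lemma gaussian_eq_affine_std_normal:
  assumes "0 \<le> s"
  shows "gaussian \<mu> s = distr std_normal_distribution borel (\<lambda>z. \<mu> + s * z)"
proof (cases "s = 0")
  case True
  interpret prob_space std_normal_distribution by (rule prob_space_normal_density) simp
  show ?thesis using True by (simp add: gaussian_def distr_const)
next
  case False
  interpret prob_space std_normal_distribution by (rule prob_space_normal_density) simp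
  have "distributed std_normal_distribution lborel (\<lambda>z. z) std_normal_density"
    by (auto simp: distributed_def distr_id2)
  then have "distributed std_normal_distribution lborel (\<lambda>z. \<mu> + s * z) (normal_density \<mu> s)"
    using normal_density_affine[of "\<lambda>z. z" 0 1 s \<mu>] False assms by simp
  then have "density lborel (normal_density \<mu> s) = distr std_normal_distribution lborel (\<lambda>z. \<mu> + s * z)"
    by (simp add: distributed_distr_eq_density)
  also have "\<dots> = distr std_normal_distribution borel (\<lambda>z. \<mu> + s * z)"
    by (rule distr_cong) auto
  finally show ?thesis using False by (simp add: gaussian_def)
qed

lemma gaussian_expected_improvement:
  assumes s: "0 \<le> s"
  shows "integrable (gaussian \<mu> s) (\<lambda>y. max (c - y) 0)"
    and "(LINT y|gaussian \<mu> s. max (c - y) 0) = EI c \<mu> s"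
proof -
  interpret prob_space std_normal_distribution by (rule prob_space_normal_density) simp
  have "integrable std_normal_distribution (\<lambda>z. max (c - (\<mu> + s * z)) 0) \<and>
    (LINT z|std_normal_distribution. max (c - (\<mu> + s * z)) 0) = EI c \<mu> s"
  proof (cases "s = 0")
    case True
    then show ?thesis using prob_space by (simp add: EI_def)
  next
    case False
    then have "c - (\<mu> + s * z) = s * ((c - \<mu>) / s - z)" for z
      by (simp add: field_simps)
    then have "max (c - (\<mu> + s * z)) 0 = s * max ((c - \<mu>) / s - z) 0" for z
      using s by (simp add: max_mult_distrib_left)
    then show ?thesis
      using False std_normal_expected_shortfall[of "(c - \<mu>) / s"]
      by (simp add: EI_def distrib_left)
  qed
  then show "integrable (gaussian \<mu> s) (\<lambda>y. max (c - y) 0)"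
    and "(LINT y|gaussian \<mu> s. max (c - y) 0) = EI c \<mu> s"
    by (simp_all add: gaussian_eq_affine_std_normal[OF s] integrable_distr_eq integral_distr)
qed

section \<open>Improvement of the indicator\<close>

text \<open>
  A new vector replaces each minimum \<open>h\<close> by \<open>min (v k) h\<close>, and
  \<open>h - min (v k) h = max (h - v k) 0\<close>. The improvement thus splits into terms that each
  see a single coordinate of the vector.
\<close>

lemma r2_improvement_eq_average_shortfall:
  assumes "finite A" "A \<noteq> {}"
  shows "r2_improvement K A v = (\<Sum>k<K. max (Min ((\<lambda>u. u k) ` A) - v k) 0) / real K"
proof -
  have "Min ((\<lambda>u. u k) ` A) - Min ((\<lambda>u. u k) ` insert v A) = max (Min ((\<lambda>u. u k) ` A) - v k) 0" for k
  proof -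
    have "Min ((\<lambda>u. u k) ` insert v A) = min (v k) (Min ((\<lambda>u. u k) ` A))"
      unfolding image_insert using assms by (intro Min_insert) auto
    then show ?thesis by simp
  qed
  then show ?thesis
    unfolding r2_improvement_def r2_indicator_def diff_divide_distrib[symmetric] sum_subtractf[symmetric]
    by simp
qed

text \<open>
  Linearity of expectation: each term of the improvement is a function of one coordinate, so
  its integral transfers to the law of that coordinate, for any coupling of the coordinates.
\<close>

lemma expected_r2_improvement:
  fixes G :: "'w \<Rightarrow> nat \<Rightarrow> real"
  assumes A: "finite A" "A \<noteq> {}"
    and meas: "\<And>k. k < K \<Longrightarrow> (\<lambda>\<omega>. G \<omega> k) \<in> borel_measurable M"
    and law: "\<And>k. k < K \<Longrightarrow> distr M borel (\<lambda>\<omega>. G \<omega> k) = gaussian (m k) (s k)"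
    and s: "\<And>k. k < K \<Longrightarrow> 0 \<le> s k"
  shows "integrable M (\<lambda>\<omega>. r2_improvement K A (G \<omega>))"
    and "(LINT \<omega>|M. r2_improvement K A (G \<omega>)) =
      (\<Sum>k<K. EI (Min ((\<lambda>v. v k) ` A)) (m k) (s k)) / real K"
proof -
  let ?c = "\<lambda>k. Min ((\<lambda>v. v k) ` A)"
  have int: "integrable M (\<lambda>\<omega>. max (?c k - G \<omega> k) 0)" if "k < K" for k
    using gaussian_expected_improvement(1)[OF s[OF that], of "m k" "?c k"] meas[OF that]
    by (simp add: law[OF that, symmetric] integrable_distr_eq)
  have EI: "(LINT \<omega>|M. max (?c k - G \<omega> k) 0) = EI (?c k) (m k) (s k)" if "k < K" for k
    using gaussian_expected_improvement(2)[OF s[OF that], of "m k" "?c k"] meas[OF that]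
    by (simp add: law[OF that, symmetric] integral_distr)
  show "integrable M (\<lambda>\<omega>. r2_improvement K A (G \<omega>))"
    unfolding r2_improvement_eq_average_shortfall[OF A] using int
    by (intro integrable_divide Bochner_Integration.integrable_sum) simp
  show "(LINT \<omega>|M. r2_improvement K A (G \<omega>)) = (\<Sum>k<K. EI (?c k) (m k) (s k)) / real K"
    unfolding r2_improvement_eq_average_shortfall[OF A] using int EI
    by (simp add: Bochner_Integration.integral_sum)
qed

section \<open>The scalar state\<close>

text \<open>
  Updating the stored scalars agrees with recomputing them from the longer archive. A nonempty
  archive is required: the minimum over an empty set carries no information, so the first
  envelope value could not be obtained by a binary minimum.
\<close>

lemma scalar_update_init:
  assumes "xs \<noteq> []"
  shows "scalar_update x (a x) (scalar_init a xs) = scalar_init a (xs @ [x])"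
  using assms
  by (auto simp: scalar_update_def scalar_init_def envelope_def training_pairs_def fun_eq_iff min.commute)

lemma average_EI_init: "average_EI K fit (scalar_init a xs) = r2_acquisition K fit a xs"
  by (simp add: fun_eq_iff average_EI_def r2_acquisition_def scalar_init_def case_prod_beta Let_def)

text \<open>
  The invariant of the scalar procedure: the stored state is a function of the archive alone.
  It turns every maximization of one procedure into a maximization of the other.
\<close>

lemma scalar_run_state:
  assumes "scalar_run X K fit a xs0 xs S" "xs0 \<noteq> []"
  shows "xs \<noteq> [] \<and> S = scalar_init a xs"
  using assms by induction (auto simp: scalar_update_init)

lemma r2_run_iff_scalar_run:
  assumes "xs0 \<noteq> []"
  shows "r2_run X K fit a xs0 xs \<longleftrightarrow> (\<exists>S. scalar_run X K fit a xs0 xs S)"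
proof
  assume "r2_run X K fit a xs0 xs"
  then show "\<exists>S. scalar_run X K fit a xs0 xs S"
  proof induction
    case init
    show ?case by (blast intro: scalar_run.init)
  next
    case (step xs x)
    then obtain S where S: "scalar_run X K fit a xs0 xs S" by blast
    then have "average_EI K fit S = r2_acquisition K fit a xs"
      using scalar_run_state assms average_EI_init by metis
    then show ?case using scalar_run.step[OF S] step.hyps by auto
  qed
next
  assume "\<exists>S. scalar_run X K fit a xs0 xs S"
  then obtain S where "scalar_run X K fit a xs0 xs S" ..
  then show "r2_run X K fit a xs0 xs"
  proof induction
    case init
    show ?case by (rule r2_run.init)
  next
    case (step xs S x)
    then have "average_EI K fit S = r2_acquisition K fit a xs"
      using scalar_run_state assms average_EI_init by metis
    then show ?case using step by (auto intro: r2_run.step)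
  qed
qed

section \<open>Equivalence of the procedures and meaning of the acquisition\<close>

theorem proposition8p1:
  fixes X :: "'x set" and f :: "'x \<Rightarrow> real ^ 'm" and z :: "real ^ 'm"
    and K :: nat and lam :: "nat \<Rightarrow> real ^ 'm"
    and fit :: "nat \<Rightarrow> ('x \<times> real) list \<Rightarrow> 'x gp_prior"
    and xs0 :: "'x list" and a :: "'x \<Rightarrow> nat \<Rightarrow> real"
  assumes "K \<ge> 1"
    and "\<And>k. k < K \<Longrightarrow> lam k \<in> weight_simplex"
    and "utopian_point X f z"
    and "xs0 \<noteq> []" and "set xs0 \<subseteq> X"
    and "\<And>k D. k < K \<Longrightarrow> valid_gp_prior X (fit k D)"
    and a: "a = achievement f z lam"
  shows
    "(\<forall>xs. r2_run X K fit a xs0 xs \<longleftrightarrow> (\<exists>S. scalar_run X K fit a xs0 xs S)) \<and>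
     (\<forall>xs S. scalar_run X K fit a xs0 xs S \<longrightarrow>
        (\<forall>k<K. env S k = envelope a xs k \<and> train_data S k = training_pairs a xs k) \<and>
        (\<forall>x\<in>X. r2_acquisition K fit a xs x = average_EI K fit S x) \<and>
        (\<forall>x. is_arg_max (r2_acquisition K fit a xs) (\<lambda>x. x \<in> X) x \<longleftrightarrow>
             is_arg_max (average_EI K fit S) (\<lambda>x. x \<in> X) x)) \<and>
     (\<forall>xs x (M :: 'w measure) (G :: 'w \<Rightarrow> nat \<Rightarrow> real).
        xs \<noteq> [] \<and> set xs \<subseteq> X \<and> x \<in> X \<and>
        (\<forall>k<K. invertible_mat (gram_mat (fit k (training_pairs a xs k)) (training_pairs a xs k))) \<and>
        prob_space M \<and>
        (\<forall>k<K. (\<lambda>\<omega>. G \<omega> k) \<in> borel_measurable M \<and>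
           distr M borel (\<lambda>\<omega>. G \<omega> k) =
             gaussian (fst (train (fit k) (training_pairs a xs k)) x)
                      (snd (train (fit k) (training_pairs a xs k)) x)) \<longrightarrow>
        integrable M (\<lambda>\<omega>. r2_improvement K (a ` set xs) (G \<omega>)) \<and>
        (LINT \<omega>|M. r2_improvement K (a ` set xs) (G \<omega>)) = r2_acquisition K fit a xs x)"
proof (intro conjI allI impI)
  fix xs
  show "r2_run X K fit a xs0 xs \<longleftrightarrow> (\<exists>S. scalar_run X K fit a xs0 xs S)"
    using \<open>xs0 \<noteq> []\<close> by (rule r2_run_iff_scalar_run)
next
  fix xs S
  assume "scalar_run X K fit a xs0 xs S"
  then have S: "S = scalar_init a xs" using scalar_run_state \<open>xs0 \<noteq> []\<close> by blast
  then have acq: "average_EI K fit S = r2_acquisition K fit a xs"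
    by (simp add: average_EI_init)
  show "env S k = envelope a xs k" "train_data S k = training_pairs a xs k" for k
    by (simp_all add: S scalar_init_def)
  show "\<forall>x\<in>X. r2_acquisition K fit a xs x = average_EI K fit S x"
    and "is_arg_max (r2_acquisition K fit a xs) (\<lambda>x. x \<in> X) x \<longleftrightarrow>
      is_arg_max (average_EI K fit S) (\<lambda>x. x \<in> X) x" for x
    by (simp_all add: acq)
next
  fix xs x and M :: "'w measure" and G :: "'w \<Rightarrow> nat \<Rightarrow> real"
  let ?D = "training_pairs a xs"
  let ?m = "\<lambda>k. fst (train (fit k) (?D k)) x" and ?s = "\<lambda>k. snd (train (fit k) (?D k)) x"
  assume H: "xs \<noteq> [] \<and> set xs \<subseteq> X \<and> x \<in> X \<and>
    (\<forall>k<K. invertible_mat (gram_mat (fit k (?D k)) (?D k))) \<and> prob_space M \<and>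
    (\<forall>k<K. (\<lambda>\<omega>. G \<omega> k) \<in> borel_measurable M \<and>
      distr M borel (\<lambda>\<omega>. G \<omega> k) = gaussian (?m k) (?s k))"
  have s: "0 \<le> ?s k" if "k < K" for k
  proof -
    have "fst ` set (?D k) \<subseteq> X" using H by (auto simp: training_pairs_def)
    then show ?thesis
      using gp_var_nonneg[OF assms(6)[OF that]] H that by (simp add: train_def gp_sd_def)
  qed
  have A: "finite (a ` set xs)" "a ` set xs \<noteq> {}" using H by auto
  have env: "Min ((\<lambda>v. v k) ` a ` set xs) = envelope a xs k" for k
    by (simp add: envelope_def image_image)
  note E = expected_r2_improvement[where A = "a ` set xs" and G = G and K = K and M = M
      and m = ?m and s = ?s, OF A _ _ s]
  show "integrable M (\<lambda>\<omega>. r2_improvement K (a ` set xs) (G \<omega>))"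
    using H by (intro E(1)) auto
  have "(LINT \<omega>|M. r2_improvement K (a ` set xs) (G \<omega>)) =
      (\<Sum>k<K. EI (envelope a xs k) (?m k) (?s k)) / real K"
    unfolding env[symmetric] using H by (intro E(2)) auto
  then show "(LINT \<omega>|M. r2_improvement K (a ` set xs) (G \<omega>)) = r2_acquisition K fit a xs x"
    by (simp add: r2_acquisition_def)
qed

end
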